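(* Suppose that $m=n$ and $\mathcal{S}\subset\mathbb{S}$. If the set $\{D_{n,n}:D=(D_{i,j})_{n\times n}\in\mathcal{S}\}$ is finite, then $\mu(\mathcal{S})=0$; in particular, this holds for any finite subset $\mathcal{S}\subset\mathbb{S}$.
   Context: $n$ is a positive integer and matrices are $n\times n$. For a positive integer $k$, $\mathbb{Z}_{(k)}=\{-k,\dots,k\}$. The Smith normal form (SNF) of an $n\times n$ integer matrix $M$ is the diagonal matrix $PMQ$ ($P,Q$ invertible over $\mathbb{Z}$) with nonnegative diagonal entries $d_1\mid d_2\mid\cdots\mid d_n$ (trailing entries may be $0$); the SNF of the zero matrix is itself. $\mathbb{S}$ is the set of $n\times n$ diagonal integer matrices whose diagonal entries $(d_1,\dots,d_n)$ are nonnegative with $d_{i+1}$ a multiple of $d_i$ for $1\le i\le n-1$. For $\mathcal{S}\subseteq\mathbb{S}$, $\mu^{(k)}(\mathcal{S})$ is the probability that $\mathrm{SNF}(M)\in\mathcal{S}$ for a random $n\times n$ matrix $M$ with independent entries uniform on $\mathbb{Z}_{(k)}$, and $\mu(\mathcal{S})=\lim_{k\to\infty}\mu^{(k)}(\mathcal{S})$ if the limit exists. *)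

theory Defs
  imports "HOL-Probability.Product_PMF" "Jordan_Normal_Form.Matrix"
begin

(* Matrices are the int matrices of Jordan_Normal_Form, with indices 0, ..., n - 1;
   the entry called (n,n) on paper is therefore (n - 1, n - 1) here. *)

definition smith_mats :: "nat \<Rightarrow> int mat set" where
  "smith_mats n = {D \<in> carrier_mat n n. diagonal_mat D \<and> (\<forall>i<n. 0 \<le> D $$ (i, i)) \<and>
     (\<forall>i. Suc i < n \<longrightarrow> D $$ (i, i) dvd D $$ (Suc i, Suc i))}"

definition is_SNF :: "int mat \<Rightarrow> int mat \<Rightarrow> bool" where
  "is_SNF M D \<longleftrightarrow> D \<in> smith_mats (dim_row M) \<and>
     (\<exists>P \<in> carrier_mat (dim_row M) (dim_row M). \<exists>Q \<in> carrier_mat (dim_row M) (dim_row M).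
        invertible_mat P \<and> invertible_mat Q \<and> D = P * M * Q)"

(* Meant for square M only, for which there is exactly one such D (classical, not proved here). *)
definition SNF :: "int mat \<Rightarrow> int mat" where
  "SNF M = (THE D. is_SNF M D)"

(* The default value 0 of Pi_pmf lies outside the index square, so mat n n never reads it. *)
definition random_mat :: "nat \<Rightarrow> nat \<Rightarrow> int mat pmf" where
  "random_mat n k =
     map_pmf (mat n n) (Pi_pmf ({..<n} \<times> {..<n}) 0 (\<lambda>_. pmf_of_set {- int k..int k}))"

definition snf_prob :: "nat \<Rightarrow> nat \<Rightarrow> int mat set \<Rightarrow> real" where
  "snf_prob n k S = measure_pmf.prob (random_mat n k) {M. SNF M \<in> S}"

(* "The density of S exists and equals c". *)
definition has_snf_density :: "nat \<Rightarrow> int mat set \<Rightarrow> real \<Rightarrow> bool" where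
  "has_snf_density n S c \<longleftrightarrow> (\<lambda>k. snf_prob n k S) \<longlonglongrightarrow> c"

end

theory Submission
  imports Defs "Jordan_Normal_Form.Determinant" "HOL-Real_Asymp.Real_Asymp"
begin

text \<open>
  If the last invariant factor of an integer matrix \<open>M\<close> is \<open>d\<close>, then every invariant factor
  divides \<open>d\<close>, and the determinant of \<open>M\<close> is up to sign their product; so
  \<open>\<bar>det M\<bar> \<le> d ^ n\<close> (also when \<open>d = 0\<close>, as then \<open>det M = 0\<close>). Hence, if only finitely many
  values \<open>d\<close> occur in \<open>S\<close>, a matrix with Smith normal form in \<open>S\<close> has its determinant in a fixed
  finite set (\<open>abs_det_le_last_invariant_factor\<close>).

  A random determinant takes a given value with probability at most \<open>n / (2 * k + 1)\<close>
  (\<open>prob_det_eq_le\<close>, a Schwartz-Zippel bound): as a function of the last entry alone the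
  determinant is affine, and its slope is the leading principal minor. Either the slope vanishes,
  which is unlikely by induction on the size, or at most one of the \<open>2 * k + 1\<close> values of the last
  entry is good. The union bound over the finite set of determinants tends to \<open>0\<close>.

  Since \<open>SNF\<close> is a definite description, all this presupposes that every square integer matrix is
  unimodularly equivalent to exactly one matrix in Smith form. Existence (\<open>smith_exists\<close>)
  comes from an entry of least positive absolute value among all equivalent matrices, in place of an
  elimination algorithm. Uniqueness (\<open>smith_equiv_eq\<close>) is reduced to the fact that a matrix with a
  corner block divisible by \<open>g\<close> that is too large for a permutation to avoid has a determinant
  divisible by \<open>g\<close>; this replaces the usual comparison of gcds of minors.
\<close>

section \<open>Unimodular equivalence of integer matrices\<close>

text \<open>
  Over the integers this is invertibility (\<open>unimodular_iff_invertible\<close>), in the form in which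
  products, elementary matrices and block triangular matrices are immediate.
\<close>

definition unimodular :: "nat \<Rightarrow> int mat \<Rightarrow> bool" where
  "unimodular n P \<longleftrightarrow> P \<in> carrier_mat n n \<and> det P dvd 1"

definition unimod_equiv :: "nat \<Rightarrow> int mat \<Rightarrow> int mat \<Rightarrow> bool" where
  "unimod_equiv n M N \<longleftrightarrow> (\<exists>P Q. unimodular n P \<and> unimodular n Q \<and> N = P * M * Q)"

lemma unimodular_one: "unimodular n (1\<^sub>m n)"
  by (simp add: unimodular_def)

lemma unimodular_mult:
  assumes "unimodular n P" "unimodular n Q"
  shows "unimodular n (P * Q)"
  using assms mult_dvd_mono[of "det P" 1 "det Q" 1] by (auto simp: unimodular_def det_mult)

text \<open>The adjugate is an inverse up to the factor \<open>det P\<close>, which here is its own inverse.\<close>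

lemma unimodular_inverse:
  assumes "unimodular n P"
  obtains R where "unimodular n R" "P * R = 1\<^sub>m n" "R * P = 1\<^sub>m n"
proof
  let ?R = "det P \<cdot>\<^sub>m adj_mat P"
  have P: "P \<in> carrier_mat n n" and d: "det P * det P = 1"
    using assms by (auto simp: unimodular_def zdvd1_eq abs_if split: if_splits)
  note adj = adj_mat[OF P]
  have one: "det P \<cdot>\<^sub>m (det P \<cdot>\<^sub>m 1\<^sub>m n) = (1\<^sub>m n :: int mat)"
    using d by (intro eq_matI) auto
  show PR: "P * ?R = 1\<^sub>m n"
    using adj one by (simp add: mult_smult_distrib[OF P adj(1)])
  show "?R * P = 1\<^sub>m n"
    using adj one by (simp add: mult_smult_assoc_mat[OF adj(1) P])
  have R: "?R \<in> carrier_mat n n" using adj by simp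
  have "det P * det ?R = 1"
    using det_mult[OF P R] PR by simp
  then show "unimodular n ?R"
    using R by (metis dvd_triv_right unimodular_def)
qed

lemma unimodular_iff_invertible:
  assumes P: "P \<in> carrier_mat n n"
  shows "unimodular n P \<longleftrightarrow> invertible_mat P"
proof
  assume "unimodular n P"
  then obtain R where "unimodular n R" "P * R = 1\<^sub>m n" "R * P = 1\<^sub>m n"
    by (rule unimodular_inverse)
  then show "invertible_mat P"
    using P by (auto simp: invertible_mat_def inverts_mat_def unimodular_def)
next
  assume "invertible_mat P"
  then obtain B where B: "P * B = 1\<^sub>m n" "B * P = 1\<^sub>m (dim_row B)"
    using P by (auto simp: invertible_mat_def inverts_mat_def)
  have "dim_col B = n" using arg_cong[OF B(1), of dim_col] by simp
  moreover have "dim_row B = n" using arg_cong[OF B(2), of dim_col] P by simp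
  ultimately have "B \<in> carrier_mat n n" by auto
  then have "det P * det B = 1" using det_mult[OF P, of B] B(1) by simp
  then show "unimodular n P" using P by (metis dvd_triv_left unimodular_def)
qed

lemma is_SNF_iff:
  assumes "M \<in> carrier_mat n n"
  shows "is_SNF M D \<longleftrightarrow> D \<in> smith_mats n \<and> unimod_equiv n M D"
proof -
  have u: "unimodular n P \<longleftrightarrow> P \<in> carrier_mat n n \<and> invertible_mat P" for P
    using unimodular_iff_invertible[of P n] by (auto simp: unimodular_def)
  show ?thesis
    unfolding is_SNF_def unimod_equiv_def u carrier_matD(1)[OF assms] by blast
qed

lemma unimod_equiv_carrier:
  "unimod_equiv n M N \<Longrightarrow> M \<in> carrier_mat n n \<Longrightarrow> N \<in> carrier_mat n n"
  by (auto simp: unimod_equiv_def unimodular_def)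

lemma unimod_equiv_refl:
  assumes "M \<in> carrier_mat n n"
  shows "unimod_equiv n M M"
  unfolding unimod_equiv_def
  by (rule exI[of _ "1\<^sub>m n"], rule exI[of _ "1\<^sub>m n"]) (use assms in \<open>auto simp: unimodular_one\<close>)

lemma unimod_equiv_left:
  assumes "M \<in> carrier_mat n n" "unimodular n P"
  shows "unimod_equiv n M (P * M)"
  unfolding unimod_equiv_def
  by (rule exI[of _ P], rule exI[of _ "1\<^sub>m n"])
    (use assms in \<open>auto simp: unimodular_one unimodular_def\<close>)

lemma unimod_equiv_right:
  assumes "M \<in> carrier_mat n n" "unimodular n Q"
  shows "unimod_equiv n M (M * Q)"
  unfolding unimod_equiv_def
  by (rule exI[of _ "1\<^sub>m n"], rule exI[of _ Q])
    (use assms in \<open>auto simp: unimodular_one unimodular_def\<close>)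

lemma unimod_equiv_trans:
  assumes M: "M \<in> carrier_mat n n" and "unimod_equiv n M N" "unimod_equiv n N L"
  shows "unimod_equiv n M L"
proof -
  obtain P Q P' Q' where PQ: "unimodular n P" "unimodular n Q" "N = P * M * Q"
    and PQ': "unimodular n P'" "unimodular n Q'" "L = P' * N * Q'"
    using assms(2,3) by (auto simp: unimod_equiv_def)
  have c: "P \<in> carrier_mat n n" "Q \<in> carrier_mat n n" "P' \<in> carrier_mat n n" "Q' \<in> carrier_mat n n"
    using PQ PQ' by (auto simp: unimodular_def)
  have "L = (P' * P) * M * (Q * Q')"
    unfolding PQ(3) PQ'(3) using c M by (simp add: assoc_mult_mat[of _ n n _ n _ n])
  then show ?thesis
    using unimodular_mult PQ PQ' unfolding unimod_equiv_def by blast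
qed

lemma unimod_equiv_sym:
  assumes M: "M \<in> carrier_mat n n" and "unimod_equiv n M N"
  shows "unimod_equiv n N M"
proof -
  obtain P Q where PQ: "unimodular n P" "unimodular n Q" "N = P * M * Q"
    using assms(2) by (auto simp: unimod_equiv_def)
  obtain P' where P': "unimodular n P'" "P' * P = 1\<^sub>m n"
    using unimodular_inverse[OF PQ(1)] by blast
  obtain Q' where Q': "unimodular n Q'" "Q * Q' = 1\<^sub>m n"
    using unimodular_inverse[OF PQ(2)] by blast
  have c: "P \<in> carrier_mat n n" "Q \<in> carrier_mat n n" "P' \<in> carrier_mat n n" "Q' \<in> carrier_mat n n"
    using PQ P' Q' by (auto simp: unimodular_def)
  have "P' * N * Q' = (P' * P) * M * (Q * Q')"
    unfolding PQ(3) using c M by (simp add: assoc_mult_mat[of _ n n _ n _ n])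
  also have "\<dots> = M" using M P' Q' by simp
  finally show ?thesis
    using P' Q' unfolding unimod_equiv_def by metis
qed

lemma unimod_equiv_addrow:
  assumes "M \<in> carrier_mat n n" "k \<noteq> l" "l < n"
  shows "unimod_equiv n M (addrow a k l M)"
  using unimod_equiv_left[of M n "addrow_mat n a k l"] addrow_mat[of M n n l a k] assms
  by (simp add: unimodular_def det_addrow_mat)

lemma unimod_equiv_addcol:
  assumes "M \<in> carrier_mat n n" "k \<noteq> l" "k < n"
  shows "unimod_equiv n M (addcol a l k M)"
  using unimod_equiv_right[of M n "addrow_mat n a k l"] addcol_mat[of M n n k a l] assms
  by (simp add: unimodular_def det_addrow_mat)

lemma unimod_equiv_swaprows:
  assumes "M \<in> carrier_mat n n" "k < n" "l < n"
  shows "unimod_equiv n M (swaprows k l M)"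
proof (cases "k = l")
  case True
  then have "swaprows k l M = M" using assms by (intro eq_matI) auto
  then show ?thesis using unimod_equiv_refl assms by simp
next
  case False
  then show ?thesis
    using unimod_equiv_left[of M n "swaprows_mat n k l"] swaprows_mat[of M n n k l] assms
    by (simp add: unimodular_def det_swaprows_mat)
qed

lemma unimod_equiv_swapcols:
  assumes "M \<in> carrier_mat n n" "k < n" "l < n"
  shows "unimod_equiv n M (swapcols k l M)"
proof (cases "k = l")
  case True
  then have "swapcols k l M = M" using assms by (intro eq_matI) auto
  then show ?thesis using unimod_equiv_refl assms by simp
next
  case False
  then show ?thesis
    using unimod_equiv_right[of M n "swaprows_mat n k l"] swapcols_mat[of M n n k l] assms
    by (simp add: unimodular_def det_swaprows_mat)
qed

lemma unimod_equiv_negate_row: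
  assumes "M \<in> carrier_mat n n" "k < n"
  shows "unimod_equiv n M (multrow k (-1) M)"
  using unimod_equiv_left[of M n "multrow_mat n k (-1)"] multrow_mat[of M n n k "-1"] assms
  by (simp add: unimodular_def det_multrow_mat)

section \<open>Uniqueness of the Smith normal form\<close>

text \<open>
  The block has \<open>k + 1\<close> rows, and only \<open>k\<close> columns lie outside it. By the pigeonhole principle each
  permutation picks an entry of the block, so each term of the Leibniz formula is divisible by \<open>g\<close>.
\<close>

lemma dvd_det_of_dvd_corner_block:
  fixes A :: "'a :: comm_ring_1 mat"
  assumes A: "A \<in> carrier_mat n n" and k: "k < n"
    and g: "\<And>i j. i \<le> k \<Longrightarrow> k \<le> j \<Longrightarrow> j < n \<Longrightarrow> g dvd A $$ (i, j)"
  shows "g dvd det A"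
  unfolding det_def'[OF A]
proof (rule dvd_sum, rule dvd_mult)
  fix p assume "p \<in> {p. p permutes {0..<n}}"
  then have p: "p permutes {0..<n}" by simp
  have "\<not> p ` {..k} \<subseteq> {..<k}"
  proof
    assume "p ` {..k} \<subseteq> {..<k}"
    then have "card (p ` {..k}) \<le> card {..<k}" by (intro card_mono) auto
    moreover have "card (p ` {..k}) = card {..k}"
      using p permutes_inj_on by (intro card_image) blast
    ultimately show False by simp
  qed
  then obtain i where i: "i \<le> k" "k \<le> p i" by (auto simp only: image_subset_iff atMost_iff lessThan_iff not_less not_all Ball_def not_imp)
  then have "i < n" "p i < n" using k permutes_in_image[OF p, of i] by auto
  then show "g dvd (\<Prod>i = 0..<n. A $$ (i, p i))"
    using i g[OF i] by (intro dvd_trans[OF _ dvd_prodI[of _ i]]) auto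
qed

lemma diagonal_mult_index:
  assumes D: "D \<in> carrier_mat n n" "diagonal_mat D" and A: "A \<in> carrier_mat n n" "i < n" "j < n"
  shows "(D * A) $$ (i, j) = D $$ (i, i) * A $$ (i, j)"
    and "(A * D) $$ (i, j) = A $$ (i, j) * D $$ (j, j)"
proof -
  have "(D * A) $$ (i, j) = (\<Sum>l = 0..<n. D $$ (i, l) * A $$ (l, j))"
    using D A by (simp add: scalar_prod_def)
  also have "\<dots> = (\<Sum>l = 0..<n. if l = i then D $$ (i, i) * A $$ (i, j) else 0)"
    using D A by (intro sum.cong) (auto simp: diagonal_mat_def)
  finally show "(D * A) $$ (i, j) = D $$ (i, i) * A $$ (i, j)" using A by simp
  have "(A * D) $$ (i, j) = (\<Sum>l = 0..<n. A $$ (i, l) * D $$ (l, j))"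
    using D A by (simp add: scalar_prod_def)
  also have "\<dots> = (\<Sum>l = 0..<n. if l = j then A $$ (i, j) * D $$ (j, j) else 0)"
    using D A by (intro sum.cong) (auto simp: diagonal_mat_def)
  finally show "(A * D) $$ (i, j) = A $$ (i, j) * D $$ (j, j)" using A by simp
qed

lemma smith_mats_dvd:
  assumes D: "D \<in> smith_mats n" and ij: "i \<le> j" "j < n"
  shows "D $$ (i, i) dvd D $$ (j, j)"
  using ij(1)
proof (induction rule: dec_induct)
  case (step m)
  then have "Suc m < n" using ij(2) by linarith
  then have "D $$ (m, m) dvd D $$ (Suc m, Suc m)" using D by (auto simp: smith_mats_def)
  with step.IH show ?case by (rule dvd_trans)
qed simp

text \<open>
  Write the equivalence as \<open>D' * U = P * D\<close> with \<open>U\<close> unimodular, that is,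
  \<open>d'\<^sub>i * U\<^sub>i\<^sub>j = P\<^sub>i\<^sub>j * d\<^sub>j\<close>. For \<open>i \<le> k \<le> j\<close> the divisibility chains turn this into
  \<open>d\<^sub>k dvd d'\<^sub>k * U\<^sub>i\<^sub>j\<close>, so (unless \<open>d'\<^sub>k = 0\<close>) the part \<open>g\<close> of \<open>d\<^sub>k\<close> that is missing from \<open>d'\<^sub>k\<close> divides a corner block
  of \<open>U\<close>, and therefore \<open>det U\<close>. So \<open>g\<close> is a unit.
\<close>

lemma smith_equiv_dvd:
  assumes D: "D \<in> smith_mats n" and D': "D' \<in> smith_mats n"
    and eq: "unimod_equiv n D D'" and k: "k < n"
  shows "D $$ (k, k) dvd D' $$ (k, k)"
proof (cases "D' $$ (k, k) = 0")
  case nz: False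
  have Dc: "D \<in> carrier_mat n n" "diagonal_mat D" and Dc': "D' \<in> carrier_mat n n" "diagonal_mat D'"
    using D D' by (auto simp: smith_mats_def)
  obtain P Q where PQ: "unimodular n P" "unimodular n Q" "D' = P * D * Q"
    using eq by (auto simp: unimod_equiv_def)
  obtain U where U: "unimodular n U" "Q * U = 1\<^sub>m n"
    using unimodular_inverse[OF PQ(2)] by blast
  have c: "P \<in> carrier_mat n n" "Q \<in> carrier_mat n n" "U \<in> carrier_mat n n"
    using PQ U by (auto simp: unimodular_def)
  have "D' * U = P * D * (Q * U)"
    unfolding PQ(3) using c Dc by (simp add: assoc_mult_mat[of _ n n _ n _ n])
  also have "\<dots> = P * D" using U c Dc by simp
  finally have DU: "D' * U = P * D" .
  define h where "h = gcd (D $$ (k, k)) (D' $$ (k, k))"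
  define g where "g = D $$ (k, k) div h"
  define e where "e = D' $$ (k, k) div h"
  have h: "h \<noteq> 0" "D $$ (k, k) = g * h" "D' $$ (k, k) = e * h"
    using nz by (auto simp: h_def g_def e_def)
  have "coprime g e"
    unfolding g_def e_def h_def using nz by (intro div_gcd_coprime) auto
  have "g dvd det U"
  proof (rule dvd_det_of_dvd_corner_block[OF c(3) k])
    fix i j assume i: "i \<le> k" and j: "k \<le> j" "j < n"
    then have "i < n" using k by simp
    have "D $$ (k, k) dvd P $$ (i, j) * D $$ (j, j)"
      using smith_mats_dvd[OF D j] by simp
    also have "\<dots> = D' $$ (i, i) * U $$ (i, j)"
      using diagonal_mult_index(1)[OF Dc' c(3) \<open>i < n\<close> j(2)]
        diagonal_mult_index(2)[OF Dc c(1) \<open>i < n\<close> j(2)] DU by simp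
    also have "\<dots> dvd D' $$ (k, k) * U $$ (i, j)"
      using smith_mats_dvd[OF D' i k] by (rule mult_dvd_mono) simp
    finally have "g dvd e * U $$ (i, j)"
      using h by (simp add: mult.commute mult.left_commute)
    then show "g dvd U $$ (i, j)"
      using \<open>coprime g e\<close> by (simp add: coprime_dvd_mult_right_iff)
  qed
  then have "g dvd 1" using U(1) dvd_trans unfolding unimodular_def by blast
  then have "g dvd e" by (rule dvd_trans) simp
  then show ?thesis unfolding h(2,3) by (rule mult_dvd_mono) simp
qed simp

lemma smith_equiv_eq:
  assumes D: "D \<in> smith_mats n" and D': "D' \<in> smith_mats n" and eq: "unimod_equiv n D D'"
  shows "D = D'"
proof (rule eq_matI)
  have c: "D \<in> carrier_mat n n" "D' \<in> carrier_mat n n" using D D' by (auto simp: smith_mats_def)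
  then show "dim_row D = dim_row D'" "dim_col D = dim_col D'" by auto
  fix i j assume "i < dim_row D'" "j < dim_col D'"
  then have ij: "i < n" "j < n" using c by auto
  show "D $$ (i, j) = D' $$ (i, j)"
  proof (cases "i = j")
    case True
    have "D $$ (i, i) dvd D' $$ (i, i)" "D' $$ (i, i) dvd D $$ (i, i)"
      using smith_equiv_dvd[OF D D' eq] smith_equiv_dvd[OF D' D unimod_equiv_sym[OF c(1) eq]] ij
      by auto
    then show ?thesis
      using D D' ij True zdvd_antisym_nonneg by (auto simp: smith_mats_def)
  next
    case False
    then show ?thesis using D D' ij by (auto simp: smith_mats_def diagonal_mat_def)
  qed
qed

section \<open>Existence of the Smith normal form\<close>

abbreviation border_mat :: "nat \<Rightarrow> int \<Rightarrow> int mat \<Rightarrow> int mat" where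
  "border_mat n a N \<equiv> four_block_mat (mat 1 1 (\<lambda>_. a)) (0\<^sub>m 1 n) (0\<^sub>m n 1) N"

lemma unimod_equiv_border:
  assumes N: "N \<in> carrier_mat n n" and eq: "unimod_equiv n N D"
  shows "unimod_equiv (Suc n) (border_mat n a N) (border_mat n a D)"
proof -
  obtain P Q where PQ: "unimodular n P" "unimodular n Q" "D = P * N * Q"
    using eq by (auto simp: unimod_equiv_def)
  have c: "P \<in> carrier_mat n n" "Q \<in> carrier_mat n n" using PQ by (auto simp: unimodular_def)
  have uni: "unimodular (Suc n) (border_mat n 1 R)" if "unimodular n R" for R
    using that det_four_block_mat_lower_left_zero[of "mat 1 1 (\<lambda>_. 1 :: int)" 1 "0\<^sub>m 1 n" n _ R]
      det_single[of "mat 1 1 (\<lambda>_. 1 :: int)"]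
    by (auto simp: unimodular_def)
  have one: "mat 1 1 (\<lambda>_. x) * mat 1 1 (\<lambda>_. y) = mat 1 1 (\<lambda>_. x * y)" for x y :: int
    by (rule eq_matI) (auto simp: scalar_prod_def)
  have mult: "border_mat n x A * border_mat n y B = border_mat n (x * y) (A * B)"
    if "A \<in> carrier_mat n n" "B \<in> carrier_mat n n" for x y A B
    using that one[of x y]
    by (subst mult_four_block_mat[of _ 1 1 _ n _ n _ _ 1 _ n]) auto
  have "border_mat n 1 P * border_mat n a N * border_mat n 1 Q = border_mat n a D"
    unfolding PQ(3) mult[OF c(1) N] mult[OF mult_carrier_mat[OF c(1) N] c(2)] by simp
  then show ?thesis
    using uni PQ unfolding unimod_equiv_def by metis
qed

lemma clear_first_row_and_column:
  assumes N: "N \<in> carrier_mat (Suc n) (Suc n)"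
    and row: "\<And>j. j < Suc n \<Longrightarrow> N $$ (0, 0) dvd N $$ (0, j)"
    and col: "\<And>i. i < Suc n \<Longrightarrow> N $$ (0, 0) dvd N $$ (i, 0)"
  shows "\<exists>N' \<in> carrier_mat n n. unimod_equiv (Suc n) N (border_mat n (N $$ (0, 0)) N')"
proof -
  define a where "a = N $$ (0, 0)"
  let ?A = "mat 1 1 (\<lambda>_. a)"
  let ?I = "mat 1 1 (\<lambda>_. 1 :: int)"
  define r where "r = mat 1 n (\<lambda>(_, j). N $$ (0, Suc j) div a)"
  define s where "s = mat n 1 (\<lambda>(i, _). N $$ (Suc i, 0) div a)"
  define B where "B = mat 1 n (\<lambda>(_, j). N $$ (0, Suc j))"
  define C where "C = mat n 1 (\<lambda>(i, _). N $$ (Suc i, 0))"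
  define X where "X = mat n n (\<lambda>(i, j). N $$ (Suc i, Suc j))"
  have car: "r \<in> carrier_mat 1 n" "s \<in> carrier_mat n 1" "B \<in> carrier_mat 1 n" "C \<in> carrier_mat n 1"
     "X \<in> carrier_mat n n" "?A \<in> carrier_mat 1 1" "?I \<in> carrier_mat 1 1"
    by (auto simp: r_def s_def B_def C_def X_def)
  have Neq: "N = four_block_mat ?A B C X"
    using N by (intro eq_matI) (auto simp: a_def B_def C_def X_def)
  \<comment> \<open>The unipotent block matrices that subtract multiples of the first row and the first column.\<close>
  let ?P = "four_block_mat ?I (0\<^sub>m 1 n) (- s) (1\<^sub>m n)"
  let ?Q = "four_block_mat ?I (- r) (0\<^sub>m n 1) (1\<^sub>m n)"
  have I: "?I = 1\<^sub>m 1" by (rule eq_matI) auto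
  have uP: "unimodular (Suc n) ?P"
    using car det_four_block_mat_upper_right_zero[of ?I 1 "0\<^sub>m 1 n" n "- s" "1\<^sub>m n"] det_single[of ?I]
    by (auto simp: unimodular_def)
  have uQ: "unimodular (Suc n) ?Q"
    using car det_four_block_mat_lower_left_zero[of ?I 1 "- r" n "0\<^sub>m n 1" "1\<^sub>m n"] det_single[of ?I]
    by (auto simp: unimodular_def)
  have sA: "(- s) * ?A + C = 0\<^sub>m n 1"
  proof (rule eq_matI)
    fix i j assume "i < dim_row (0\<^sub>m n 1)" "j < dim_col (0\<^sub>m n 1)"
    then show "((- s) * ?A + C) $$ (i, j) = 0\<^sub>m n 1 $$ (i, j)"
      using col[of "Suc i"] car by (auto simp: scalar_prod_def s_def C_def a_def)
  qed (use car in auto)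
  have Ar: "?A * (- r) + B = 0\<^sub>m 1 n"
  proof (rule eq_matI)
    fix i j assume "i < dim_row (0\<^sub>m 1 n)" "j < dim_col (0\<^sub>m 1 n)"
    then show "(?A * (- r) + B) $$ (i, j) = 0\<^sub>m 1 n $$ (i, j)"
      using row[of "Suc j"] car by (auto simp: scalar_prod_def r_def B_def a_def)
  qed (use car in auto)
  let ?X = "(- s) * B + X"
  have X: "?X \<in> carrier_mat n n" using car by auto
  have "?P * N = four_block_mat (?I * ?A + 0\<^sub>m 1 n * C) (?I * B + 0\<^sub>m 1 n * X)
      ((- s) * ?A + 1\<^sub>m n * C) ((- s) * B + 1\<^sub>m n * X)"
    unfolding Neq by (rule mult_four_block_mat) (use car in auto)
  also have "\<dots> = four_block_mat ?A B (0\<^sub>m n 1) ?X"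
    unfolding I left_mult_one_mat[OF car(3)] left_mult_one_mat[OF car(4)]
      left_mult_one_mat[OF car(5)] left_mult_one_mat[OF car(6)] sA
      left_mult_zero_mat[OF car(4)] left_mult_zero_mat[OF car(5)]
      right_add_zero_mat[OF car(3)] right_add_zero_mat[OF car(6)] ..
  finally have "?P * N * ?Q = four_block_mat (?A * ?I + B * 0\<^sub>m n 1) (?A * (- r) + B * 1\<^sub>m n)
      (0\<^sub>m n 1 * ?I + ?X * 0\<^sub>m n 1) (0\<^sub>m n 1 * (- r) + ?X * 1\<^sub>m n)"
    by (simp only:) (rule mult_four_block_mat, use car X in auto)
  also have "\<dots> = border_mat n a ?X"
    unfolding I right_mult_one_mat[OF car(3)] right_mult_one_mat[OF car(6)]
      right_mult_one_mat[OF X] right_mult_zero_mat[OF car(3)] right_mult_zero_mat[OF X] Ar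
      left_mult_zero_mat[OF uminus_carrier_mat[OF car(1)]] left_add_zero_mat[OF X]
    using car by simp
  finally have "?P * N * ?Q = border_mat n a ?X" .
  note this X
  then show ?thesis
    using uP uQ unfolding unimod_equiv_def a_def by metis
qed

lemma dvd_unimod_equiv:
  assumes N: "N \<in> carrier_mat n n" and eq: "unimod_equiv n N D"
    and g: "\<And>i j. i < n \<Longrightarrow> j < n \<Longrightarrow> g dvd N $$ (i, j)" and ij: "i < n" "j < n"
  shows "g dvd D $$ (i, j)"
proof -
  obtain P Q where PQ: "unimodular n P" "unimodular n Q" "D = P * N * Q"
    using eq by (auto simp: unimod_equiv_def)
  have c: "P \<in> carrier_mat n n" "Q \<in> carrier_mat n n" using PQ by (auto simp: unimodular_def)
  have PN: "g dvd (P * N) $$ (i, j)" if "i < n" "j < n" for i j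
    using that c N g by (auto simp: scalar_prod_def intro!: dvd_sum)
  have "D $$ (i, j) = (\<Sum>l = 0..<n. (P * N) $$ (i, l) * Q $$ (l, j))"
    unfolding PQ(3) using ij c N
    by (simp add: scalar_prod_def del: assoc_mult_mat)
  also have "g dvd \<dots>" using PN ij by (intro dvd_sum dvd_mult2) auto
  finally show ?thesis .
qed

lemma border_mat_smith:
  assumes D: "D \<in> smith_mats n" and a: "0 \<le> a"
    and dvd: "\<And>i. i < n \<Longrightarrow> a dvd D $$ (i, i)"
  shows "border_mat n a D \<in> smith_mats (Suc n)"
proof -
  have Dc: "D \<in> carrier_mat n n" using D by (auto simp: smith_mats_def)
  have idx: "border_mat n a D $$ (i, i) = (case i of 0 \<Rightarrow> a | Suc l \<Rightarrow> D $$ (l, l))" if "i < Suc n" for i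
    using that Dc by (auto split: nat.split)
  have "diagonal_mat (border_mat n a D)"
    using D Dc by (auto simp: diagonal_mat_def smith_mats_def)
  moreover have "0 \<le> border_mat n a D $$ (i, i)" if "i < Suc n" for i
    using that D a unfolding idx[OF that] by (auto simp: smith_mats_def split: nat.split)
  moreover have "border_mat n a D $$ (i, i) dvd border_mat n a D $$ (Suc i, Suc i)" if "Suc i < Suc n" for i
    using that D dvd unfolding idx[OF that] idx[OF Suc_lessD[OF that]]
    by (auto simp: smith_mats_def split: nat.split)
  moreover have "border_mat n a D \<in> carrier_mat (Suc n) (Suc n)" using Dc by auto
  ultimately show ?thesis unfolding smith_mats_def by blast
qed

text \<open>
  A nonzero entry of least absolute value among all matrices equivalent to \<open>M\<close> can be moved to the
  top left corner and made positive. Such an entry is the first invariant factor of \<open>M\<close>.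
\<close>

lemma minimal_entry:
  assumes M: "M \<in> carrier_mat n n" and nz: "i0 < n" "j0 < n" "M $$ (i0, j0) \<noteq> 0"
  obtains N where "unimod_equiv n M N" "N $$ (0, 0) > 0"
    "\<And>L i j. unimod_equiv n M L \<Longrightarrow> i < n \<Longrightarrow> j < n \<Longrightarrow> L $$ (i, j) \<noteq> 0 \<Longrightarrow>
       N $$ (0, 0) \<le> \<bar>L $$ (i, j)\<bar>"
proof -
  define R where "R a \<longleftrightarrow> (\<exists>L i j. unimod_equiv n M L \<and> i < n \<and> j < n \<and> L $$ (i, j) \<noteq> 0 \<and>
    a = nat \<bar>L $$ (i, j)\<bar>)" for a
  define a where "a = (LEAST a. R a)"
  have "R (nat \<bar>M $$ (i0, j0)\<bar>)"
    using unimod_equiv_refl[OF M] nz unfolding R_def by blast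
  then have "R a" unfolding a_def by (rule LeastI)
  then obtain L i j where L: "unimod_equiv n M L" "i < n" "j < n" "L $$ (i, j) \<noteq> 0"
    "a = nat \<bar>L $$ (i, j)\<bar>" unfolding R_def by blast
  have min: "int a \<le> \<bar>L $$ (i, j)\<bar>"
    if "unimod_equiv n M L" "i < n" "j < n" "L $$ (i, j) \<noteq> 0" for L i j
  proof -
    have "R (nat \<bar>L $$ (i, j)\<bar>)" using that unfolding R_def by blast
    then have "a \<le> nat \<bar>L $$ (i, j)\<bar>" unfolding a_def by (rule Least_le)
    then show ?thesis by simp
  qed
  have n: "0 < n" using nz by simp
  note Lc = unimod_equiv_carrier[OF L(1) M]
  let ?L1 = "swaprows 0 i L"
  let ?L2 = "swapcols 0 j ?L1"
  have L1: "unimod_equiv n M ?L1"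
    by (rule unimod_equiv_trans[OF M L(1) unimod_equiv_swaprows[OF Lc n L(2)]])
  note L1c = unimod_equiv_carrier[OF L1 M]
  have L2: "unimod_equiv n M ?L2"
    by (rule unimod_equiv_trans[OF M L1 unimod_equiv_swapcols[OF L1c n L(3)]])
  note L2c = unimod_equiv_carrier[OF L2 M]
  have L2_00: "?L2 $$ (0, 0) = L $$ (i, j)"
    using Lc n L(2,3) by auto
  have L3: "unimod_equiv n M (multrow 0 (-1) ?L2)"
    using unimod_equiv_trans[OF M L2 unimod_equiv_negate_row[OF L2c n]] .
  have L3_00: "multrow 0 (-1) ?L2 $$ (0, 0) = - L $$ (i, j)"
    using L2_00 n carrier_matD[OF L2c] by (simp del: index_mat_swapcols index_mat_swaprows)
  show ?thesis
  proof (cases "L $$ (i, j) > 0")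
    case True
    then show ?thesis using that[OF L2] min L(5) L2_00 by auto
  next
    case False
    then show ?thesis using that[OF L3] min L(4,5) L3_00 by auto
  qed
qed

text \<open>
  For a matrix with a minimal entry \<open>a\<close> at the top left, one row operation replaces an entry of
  the first column by its remainder modulo \<open>a\<close>, which minimality forces to be \<open>0\<close>; likewise for
  the first row. After clearing, a row of the remaining block can be added to the first row without
  changing the corner, so \<open>a\<close> divides the whole block, and the induction goes on with that block.
\<close>

lemma smith_exists:
  assumes "M \<in> carrier_mat n n"
  shows "\<exists>D \<in> smith_mats n. unimod_equiv n M D"
  using assms
proof (induction n arbitrary: M)
  case 0
  then show ?case
    using unimod_equiv_refl[OF 0] by (auto simp: smith_mats_def diagonal_mat_def intro!: bexI[of _ M])
next
  case (Suc n M)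
  show ?case
  proof (cases "\<forall>i<Suc n. \<forall>j<Suc n. M $$ (i, j) = 0")
    case True
    then have "M \<in> smith_mats (Suc n)"
      using Suc.prems by (auto simp: smith_mats_def diagonal_mat_def)
    then show ?thesis using unimod_equiv_refl[OF Suc.prems] by blast
  next
    case False
    then obtain N where N: "unimod_equiv (Suc n) M N" "N $$ (0, 0) > 0" and
      min: "\<And>L i j. unimod_equiv (Suc n) M L \<Longrightarrow> i < Suc n \<Longrightarrow> j < Suc n \<Longrightarrow> L $$ (i, j) \<noteq> 0 \<Longrightarrow>
       N $$ (0, 0) \<le> \<bar>L $$ (i, j)\<bar>"
      using minimal_entry[OF Suc.prems] by metis
    define a where "a = N $$ (0, 0)"
    have a: "a > 0" using N a_def by simp
    have small: "L $$ (i, j) = 0"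
      if "unimod_equiv (Suc n) M L" "i < Suc n" "j < Suc n" "\<bar>L $$ (i, j)\<bar> < a" for L i j
      using min[OF that(1-3)] that(4) by (auto simp: a_def)
    have dvd_col: "a dvd L $$ (i, 0)"
      if L: "unimod_equiv (Suc n) M L" "L $$ (0, 0) = a" and i: "i < Suc n" for L i
    proof (cases "i = 0")
      case i0: False
      note Lc = unimod_equiv_carrier[OF L(1) Suc.prems]
      let ?L' = "addrow (- (L $$ (i, 0) div a)) i 0 L"
      have "?L' $$ (i, 0) = L $$ (i, 0) mod a"
        using Lc i L(2) by (simp add: minus_div_mult_eq_mod[symmetric])
      moreover have "unimod_equiv (Suc n) M ?L'"
        using unimod_equiv_trans[OF Suc.prems L(1) unimod_equiv_addrow[OF Lc i0]] by simp
      ultimately have "L $$ (i, 0) mod a = 0" using small[of ?L' i 0] i a by simp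
      then show ?thesis by auto
    qed (use L in simp)
    have dvd_row: "a dvd L $$ (0, j)"
      if L: "unimod_equiv (Suc n) M L" "L $$ (0, 0) = a" and j: "j < Suc n" for L j
    proof (cases "j = 0")
      case j0: False
      note Lc = unimod_equiv_carrier[OF L(1) Suc.prems]
      let ?L' = "addcol (- (L $$ (0, j) div a)) j 0 L"
      have "?L' $$ (0, j) = L $$ (0, j) mod a"
        using Lc j L(2) by (simp add: minus_div_mult_eq_mod[symmetric])
      moreover have "unimod_equiv (Suc n) M ?L'"
        using unimod_equiv_trans[OF Suc.prems L(1) unimod_equiv_addcol[OF Lc j0[symmetric]]] by simp
      ultimately have "L $$ (0, j) mod a = 0" using small[of ?L' 0 j] j a by simp
      then show ?thesis by auto
    qed (use L in simp)
    obtain N' where N': "N' \<in> carrier_mat n n" and "unimod_equiv (Suc n) N (border_mat n a N')"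
      using clear_first_row_and_column[OF unimod_equiv_carrier[OF N(1) Suc.prems]]
        dvd_row[OF N(1)] dvd_col[OF N(1)] unfolding a_def by blast
    then have bN': "unimod_equiv (Suc n) M (border_mat n a N')"
      using unimod_equiv_trans[OF Suc.prems N(1)] by blast
    \<comment> \<open>Add row \<open>Suc i\<close> to row \<open>0\<close>: entry \<open>(i, j)\<close> of the block then stands in the first row.\<close>
    have dvd_N': "a dvd N' $$ (i, j)" if ij: "i < n" "j < n" for i j
    proof -
      let ?L = "addrow 1 0 (Suc i) (border_mat n a N')"
      have c: "border_mat n a N' \<in> carrier_mat (Suc n) (Suc n)" using N' by auto
      have "unimod_equiv (Suc n) M ?L"
        using unimod_equiv_trans[OF Suc.prems bN' unimod_equiv_addrow[OF c]] ij by simp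
      moreover have "?L $$ (0, 0) = a" "?L $$ (0, Suc j) = N' $$ (i, j)"
        using N' ij by auto
      ultimately show ?thesis using dvd_row[of ?L "Suc j"] ij by simp
    qed
    obtain D where D: "D \<in> smith_mats n" "unimod_equiv n N' D"
      using Suc.IH[OF N'] by blast
    have "border_mat n a D \<in> smith_mats (Suc n)"
      using border_mat_smith[OF D(1)] dvd_unimod_equiv[OF N' D(2) dvd_N'] a by simp
    moreover have "unimod_equiv (Suc n) M (border_mat n a D)"
      using unimod_equiv_trans[OF Suc.prems bN' unimod_equiv_border[OF N' D(2)]] .
    ultimately show ?thesis by blast
  qed
qed

text \<open>Existence and uniqueness together make the definite description meaningful.\<close>

lemma is_SNF_SNF:
  assumes M: "M \<in> carrier_mat n n"
  shows "is_SNF M (SNF M)"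
proof -
  obtain D where D: "is_SNF M D" using smith_exists[OF M] is_SNF_iff[OF M] by blast
  have "E = D" if E: "is_SNF M E" for E
  proof -
    have "unimod_equiv n E M" "unimod_equiv n M D" "E \<in> smith_mats n" "D \<in> smith_mats n"
      using E D unimod_equiv_sym[OF M] unfolding is_SNF_iff[OF M] by auto
    then show ?thesis
      using smith_equiv_eq unimod_equiv_trans[of E n M D] by (auto simp: smith_mats_def)
  qed
  then show ?thesis unfolding SNF_def using D by (metis theI)
qed

section \<open>The determinant in terms of the last invariant factor\<close>

lemma abs_det_le_last_invariant_factor:
  assumes M: "M \<in> carrier_mat n n" and n: "n > 0"
  shows "\<bar>det M\<bar> \<le> SNF M $$ (n - 1, n - 1) ^ n"
proof -
  define D where "D = SNF M"
  define d where "d = D $$ (n - 1, n - 1)"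
  have D: "D \<in> smith_mats n" "unimod_equiv n M D"
    using is_SNF_SNF[OF M] is_SNF_iff[OF M] D_def by auto
  then obtain P Q where PQ: "unimodular n P" "unimodular n Q" "D = P * M * Q"
    by (auto simp: unimod_equiv_def)
  have c: "P \<in> carrier_mat n n" "Q \<in> carrier_mat n n" "\<bar>det P\<bar> = 1" "\<bar>det Q\<bar> = 1"
    using PQ by (auto simp: unimodular_def)
  have "\<bar>det D\<bar> = \<bar>det M\<bar>"
    unfolding PQ(3) using c M by (simp add: det_mult[of _ n] abs_mult)
  moreover have Dc: "D \<in> carrier_mat n n" "diagonal_mat D" using D by (auto simp: smith_mats_def)
  then have "det D = (\<Prod>i = 0..<n. D $$ (i, i))"
    by (subst det_lower_triangular[OF _ Dc(1)]) (auto simp: diagonal_mat_def prod_list_diag_prod)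
  moreover have nonneg: "0 \<le> D $$ (i, i)" if "i < n" for i
    using D that by (auto simp: smith_mats_def)
  moreover have "(\<Prod>i = 0..<n. D $$ (i, i)) \<le> d ^ n"
  proof (cases "d = 0")
    \<comment> \<open>Every integer divides \<open>0\<close>, so here divisibility gives no bound; but one factor is \<open>d\<close>.\<close>
    case True
    then have "(\<Prod>i = 0..<n. D $$ (i, i)) = 0"
      using n by (auto simp: d_def intro!: bexI[of _ "n - 1"])
    moreover have "0 \<le> d ^ n" using True by simp
    ultimately show ?thesis by (rule ord_eq_le_trans)
  next
    case False
    then have "D $$ (i, i) \<le> d" if "i < n" for i
      using that smith_mats_dvd[OF D(1), of i "n - 1"] nonneg[of "n - 1"] n
      by (auto simp: d_def intro!: zdvd_imp_le)
    then have "(\<Prod>i = 0..<n. D $$ (i, i)) \<le> (\<Prod>i = 0..<n. d)"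
      using nonneg by (intro prod_mono) auto
    then show ?thesis by simp
  qed
  moreover have "0 \<le> (\<Prod>i = 0..<n. D $$ (i, i))" using nonneg by (intro prod_nonneg) auto
  ultimately show ?thesis
    unfolding d_def D_def[symmetric] by linarith
qed

section \<open>The determinant of a random matrix rarely takes a given value\<close>

text \<open>Expand along the last row: its cofactors do not see the change of the last entry.\<close>

lemma det_update_last_entry:
  fixes f :: "nat \<times> nat \<Rightarrow> 'a :: comm_ring_1"
  shows "det (mat (Suc m) (Suc m) (f((m, m) := y))) - det (mat (Suc m) (Suc m) (f((m, m) := x)))
    = (y - x) * det (mat m m f)"
proof -
  let ?A = "\<lambda>y. mat (Suc m) (Suc m) (f((m, m) := y))"
  have cof: "cofactor (?A y) m j = cofactor (?A x) m j" if "j < m" for j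
    unfolding cofactor_def
    by (intro arg_cong2[of _ _ _ _ "(*)"] arg_cong[of _ _ det] eq_matI refl)
       (use that in \<open>auto simp: mat_delete_def\<close>)
  have "mat_delete (?A y) m m = mat m m f" for y
    by (rule eq_matI) (auto simp: mat_delete_def)
  then have "cofactor (?A y) m m = det (mat m m f)" for y
    by (simp add: cofactor_def power_add flip: power_mult_distrib)
  then have "det (?A y) = (\<Sum>j<m. f (m, j) * cofactor (?A y) m j) + y * det (mat m m f)" for y
    by (subst laplace_expansion_row[of _ "Suc m" m]) (auto intro!: sum.cong)
  then show ?thesis using cof by (simp add: algebra_simps)
qed

text \<open>
  Condition on the first experiment: its bad outcomes \<open>B\<close> are charged with their full
  probability, and after every other outcome the event has conditional probability at most \<open>e\<close>.
\<close>

lemma prob_bind_pmf_le: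
  assumes "\<And>x. x \<notin> B \<Longrightarrow> measure_pmf.prob (K x) A \<le> e" and "e \<ge> 0"
  shows "measure_pmf.prob (bind_pmf q K) A \<le> measure_pmf.prob q B + e"
proof -
  have "emeasure (bind_pmf q K) A = (\<integral>\<^sup>+ x. emeasure (K x) A \<partial>q)"
    by simp
  also have "\<dots> \<le> (\<integral>\<^sup>+ x. indicator B x + ennreal e \<partial>q)"
  proof (rule nn_integral_mono)
    fix x
    show "emeasure (K x) A \<le> indicator B x + ennreal e"
      using assms measure_pmf.emeasure_le_1[of "K x" A]
      by (cases "x \<in> B") (auto simp: measure_pmf.emeasure_eq_measure add_increasing2 intro!: ennreal_leI)
  qed
  also have "\<dots> = ennreal (measure_pmf.prob q B + e)"
    using assms(2) by (simp add: nn_integral_add measure_pmf.emeasure_eq_measure)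
  finally show ?thesis
    using assms(2) by (simp add: measure_pmf.emeasure_eq_measure flip: ennreal_plus)
qed

text \<open>
  Draw the last entry after all others. If the leading principal minor is nonzero, the affine
  dependence on the last entry leaves at most one good value for it. The side condition on \<open>c\<close>
  excludes the value \<open>1\<close> for the empty matrix, which is certain there; the induction needs size \<open>0\<close> only
  for the value \<open>0\<close> of the minor.
\<close>

lemma prob_det_eq_le:
  fixes p :: "'a :: idom pmf"
  assumes p: "\<And>x. pmf p x \<le> e" and c: "n > 0 \<or> c \<noteq> 1"
  shows "measure_pmf.prob (Pi_pmf ({..<n} \<times> {..<n}) 0 (\<lambda>_. p)) {f. det (mat n n f) = c} \<le> real n * e"
  using c
proof (induction n arbitrary: c)
  case 0
  then show ?case by (auto simp: eq_commute[of 1])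
next
  case (Suc m)
  define A where "A = {..<Suc m} \<times> {..<Suc m} - {(m, m)}"
  define X where "X = {f. det (mat (Suc m) (Suc m) f) = c}"
  define B where "B = {f :: nat \<times> nat \<Rightarrow> 'a. det (mat m m f) = 0}"
  let ?q = "Pi_pmf A 0 (\<lambda>_. p)"
  have e: "e \<ge> 0" using p[of 0] pmf_nonneg[of p 0] by linarith
  have sub: "{..<m} \<times> {..<m} \<subseteq> A" and finA: "finite A" and ins: "{..<Suc m} \<times> {..<Suc m} = insert (m, m) A"
    and notin: "(m, m) \<notin> A"
    by (auto simp: A_def)
  have split: "Pi_pmf ({..<Suc m} \<times> {..<Suc m}) 0 (\<lambda>_. p) =
      bind_pmf ?q (\<lambda>f. map_pmf (\<lambda>y. f((m, m) := y)) p)"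
    unfolding ins Pi_pmf_insert'[OF finA notin] map_pmf_def by (rule bind_commute_pmf)
  have "measure_pmf.prob (map_pmf (\<lambda>y. f((m, m) := y)) p) X \<le> e" if "f \<notin> B" for f
  proof -
    let ?Y = "(\<lambda>y. f((m, m) := y)) -` X"
    have "y = x" if "y \<in> ?Y" "x \<in> ?Y" for x y
      using det_update_last_entry[of m f y x] that \<open>f \<notin> B\<close> by (auto simp: X_def B_def)
    then obtain x where "?Y \<subseteq> {x}" by blast
    then have "measure_pmf.prob p ?Y \<le> measure_pmf.prob p {x}"
      by (intro measure_pmf.finite_measure_mono) auto
    also have "\<dots> \<le> e" using p by (simp add: measure_pmf_single)
    finally show ?thesis by simp
  qed
  then have "measure_pmf.prob (Pi_pmf ({..<Suc m} \<times> {..<Suc m}) 0 (\<lambda>_. p)) X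
      \<le> measure_pmf.prob ?q B + e"
    unfolding split using e by (rule prob_bind_pmf_le)
  also have "measure_pmf.prob ?q B = measure_pmf.prob (Pi_pmf ({..<m} \<times> {..<m}) 0 (\<lambda>_. p)) B"
  proof -
    have "mat m m (\<lambda>x. if x \<in> {..<m} \<times> {..<m} then f x else 0) = mat m m f" for f :: "nat \<times> nat \<Rightarrow> 'a"
      by (rule eq_matI) auto
    then show ?thesis
      unfolding Pi_pmf_subset[OF finA sub] B_def by simp
  qed
  also have "\<dots> \<le> real m * e"
    unfolding B_def by (rule Suc.IH) simp
  finally show ?case by (simp add: X_def algebra_simps)
qed

section \<open>Density zero\<close>

lemma snf_prob_le:
  assumes n: "n > 0" and fin: "finite F"
    and F: "\<And>M. M \<in> carrier_mat n n \<Longrightarrow> SNF M \<in> S \<Longrightarrow> det M \<in> F"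
  shows "snf_prob n k S \<le> real (card F) * (real n / (2 * real k + 1))"
proof -
  let ?p = "pmf_of_set {- int k..int k}"
  let ?q = "Pi_pmf ({..<n} \<times> {..<n}) 0 (\<lambda>_. ?p)"
  have "snf_prob n k S = measure_pmf.prob ?q {f. SNF (mat n n f) \<in> S}"
    by (simp add: snf_prob_def random_mat_def vimage_def)
  also have "\<dots> \<le> measure_pmf.prob ?q (\<Union>c\<in>F. {f. det (mat n n f) = c})"
    using F by (intro measure_pmf.finite_measure_mono) auto
  also have "\<dots> \<le> (\<Sum>c\<in>F. measure_pmf.prob ?q {f. det (mat n n f) = c})"
    using fin by (intro measure_pmf.finite_measure_subadditive_finite) auto
  also have "\<dots> \<le> (\<Sum>c\<in>F. real n * (1 / (2 * real k + 1)))"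
  proof (intro sum_mono prob_det_eq_le)
    fix x :: int
    have "pmf ?p x = indicator {- int k..int k} x / real (nat (2 * int k + 1))"
      by (subst pmf_of_set) (auto simp: algebra_simps)
    also have "\<dots> \<le> 1 / (2 * real k + 1)"
      by (auto simp: indicator_def)
    finally show "pmf ?p x \<le> 1 / (2 * real k + 1)" .
  qed (use n in auto)
  finally show ?thesis by simp
qed

lemma has_snf_density_zero:
  assumes n: "n > 0" and fin: "finite {D $$ (n - 1, n - 1) | D. D \<in> S}"
  shows "has_snf_density n S 0"
proof -
  define F where "F = (\<Union>d\<in>{D $$ (n - 1, n - 1) | D. D \<in> S}. {- (d ^ n)..d ^ n})"
  have "finite F" unfolding F_def using fin by blast
  moreover have "det M \<in> F" if "M \<in> carrier_mat n n" "SNF M \<in> S" for M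
    using abs_det_le_last_invariant_factor[OF that(1) n] that(2)
    unfolding F_def by (auto simp: abs_le_iff intro!: exI[of _ "SNF M $$ (n - 1, n - 1)"])
  ultimately have le: "snf_prob n k S \<le> real (card F) * (real n / (2 * real k + 1))" for k
    using n by (intro snf_prob_le) auto
  have "(\<lambda>k. real (card F) * (real n / (2 * real k + 1))) \<longlonglongrightarrow> real (card F) * 0"
    by (intro tendsto_mult_left) real_asymp
  then have lim: "(\<lambda>k. real (card F) * (real n / (2 * real k + 1))) \<longlonglongrightarrow> 0" by simp
  show ?thesis
    unfolding has_snf_density_def
    by (rule tendsto_sandwich[OF _ _ tendsto_const lim])
       (use le in \<open>auto simp: snf_prob_def intro!: always_eventually\<close>)
qed

theorem theorem4p7:
  fixes n :: nat
  assumes "n > 0"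
  shows "(\<forall>S \<subseteq> smith_mats n. finite {D $$ (n - 1, n - 1) | D. D \<in> S} \<longrightarrow> has_snf_density n S 0)
       \<and> (\<forall>S \<subseteq> smith_mats n. finite S \<longrightarrow> has_snf_density n S 0)"
proof (intro conjI allI impI)
  fix S :: "int mat set" assume "finite {D $$ (n - 1, n - 1) | D. D \<in> S}"
  then show "has_snf_density n S 0" using assms by (rule has_snf_density_zero[rotated])
next
  fix S :: "int mat set" assume "finite S"
  then show "has_snf_density n S 0" using assms by (intro has_snf_density_zero) auto
qed

end
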